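(* Let $m\ge 3$ be an integer. Let $m=cy$ be any factorization of $m$ into positive integers with $c\ge 2$, and let $m-1=px$ be any factorization of $m-1$ into positive integers, such that $c>p$ and $x>y$. Put $n=cx$, $d=c-p$, $a=yd$, $b=xd$. Then $b=n-m+1$ and there exists an $(a,b)$-regular bipartite graph of order $(n,m)$.
   Context: All graphs are finite, simple and undirected. A bipartite graph $G=(U,V;E)$ has color classes $U,V$; it is of order $(n,m)$ if $|U|=n$ and $|V|=m$, and it is $(a,b)$-regular if every vertex of $U$ has degree $a$ and every vertex of $V$ has degree $b$. *)

theory Defs
  imports "Graph_Theory.Pair_Digraph"
begin

(* pair_graph is the library's locale for finite simple undirected graphs: an
   undirected edge {u, v} is represented by the two arcs (u, v) and (v, u), and
   loops are excluded. *)
definition bipartite_graph :: "'a pair_pre_digraph \<Rightarrow> 'a set \<Rightarrow> 'a set \<Rightarrow> bool" where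
  "bipartite_graph G U V \<longleftrightarrow>
     pair_graph G \<and> pverts G = U \<union> V \<and> U \<inter> V = {} \<and>
     (\<forall>(u, v) \<in> parcs G. u \<in> U \<and> v \<in> V \<or> u \<in> V \<and> v \<in> U)"

definition bipartite_of_order ::
  "'a pair_pre_digraph \<Rightarrow> 'a set \<Rightarrow> 'a set \<Rightarrow> nat \<Rightarrow> nat \<Rightarrow> bool" where
  "bipartite_of_order G U V n m \<longleftrightarrow> bipartite_graph G U V \<and> card U = n \<and> card V = m"

(* Each undirected edge at v contributes exactly one arc leaving v, so out_degree
   is the degree of v in the undirected graph. *)
definition biregular ::
  "'a pair_pre_digraph \<Rightarrow> 'a set \<Rightarrow> 'a set \<Rightarrow> nat \<Rightarrow> nat \<Rightarrow> bool" where
  "biregular G U V a b \<longleftrightarrow>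
     bipartite_graph G U V \<and>
     (\<forall>u \<in> U. out_degree (with_proj G) u = a) \<and>
     (\<forall>v \<in> V. out_degree (with_proj G) v = b)"

end

theory Submission
  imports Defs
begin

(* Both sides are indexed by initial segments of the naturals whose lengths, c * x and c * y, are
   multiples of c. Joining i and j iff (i + j) mod c < d is d-regular on every pair of blocks
   of c consecutive indices, so i has y blocks of d neighbours each, and j has x of them. *)

text \<open>Adding \<open>k\<close> permutes the residues modulo \<open>c\<close>, so each of the
  \<open>d\<close> residues below \<open>d\<close> is hit by exactly one index of the block.\<close>

lemma card_shifted_residues_less:
  fixes c d k :: nat
  assumes "0 < c" "d \<le> c"
  shows "card {i. i < c \<and> (k + i) mod c < d} = d"
proof -
  let ?f = "\<lambda>i. (k + i) mod c"
  have inj: "inj_on ?f {..<c}"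
  proof (rule linorder_inj_onI')
    fix i j assume "i \<in> {..<c}" "j \<in> {..<c}" "i < j"
    \<comment> \<open>The difference is \<open>j - i\<close>, which lies strictly between 0 and
      \<open>c\<close>.\<close>
    then have "\<not> c dvd (k + j) - (k + i)"
      by (auto dest: dvd_imp_le)
    then show "?f i \<noteq> ?f j"
      using \<open>i < j\<close> mod_eq_dvd_iff_nat[of "k + i" "k + j" c] by auto
  qed
  have surj: "?f ` {..<c} = {..<c}"
    using assms(1) by (intro endo_inj_surj inj) auto
  have "?f ` {i. i < c \<and> ?f i < d} = ?f ` {..<c} \<inter> {..<d}"
    by auto
  also have "\<dots> = {..<d}"
    unfolding surj using assms(2) by auto
  finally have "?f ` {i. i < c \<and> ?f i < d} = {..<d}" .
  moreover have "inj_on ?f {i. i < c \<and> ?f i < d}"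
    by (rule inj_on_subset[OF inj]) auto
  ultimately show ?thesis
    by (simp flip: card_image)
qed

text \<open>Induction on the number of blocks: the last block is the first one translated by
  \<open>c * y\<close>, a multiple of \<open>c\<close>, so residues do not change. The arbitrary
  shift \<open>k\<close> lets one count serve the vertices of both classes.\<close>

lemma card_periodic_residues_less:
  fixes c d k y :: nat
  assumes "0 < c" "d \<le> c"
  shows "card {j. j < c * y \<and> (k + j) mod c < d} = y * d"
proof (induction y)
  case (Suc y)
  let ?A = "{j. j < c * y \<and> (k + j) mod c < d}"
  let ?B = "{i. i < c \<and> (k + i) mod c < d}"
  have shift: "(k + (c * y + i)) mod c = (k + i) mod c" for i
    by (simp add: add.left_commute[of k])
  have "{j. j < c * Suc y \<and> (k + j) mod c < d} = ?A \<union> (+) (c * y) ` ?B" (is "?L = ?R")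
  proof (rule set_eqI)
    fix j
    show "j \<in> ?L \<longleftrightarrow> j \<in> ?R"
    proof (cases "j < c * y")
      case False
      \<comment> \<open>With this offset, \<open>j < c * Suc y\<close> amounts to
        \<open>i < c\<close>.\<close>
      then obtain i where "j = c * y + i"
        using le_Suc_ex not_less by blast
      then show ?thesis
        by (auto simp: shift)
    qed auto
  qed
  moreover have "card (?A \<union> (+) (c * y) ` ?B) = card ?A + card ((+) (c * y) ` ?B)"
    by (rule card_Un_disjoint) auto
  ultimately show ?case
    using Suc card_shifted_residues_less[OF assms] by (simp add: card_image)
qed simp

lemma exists_biregular_bipartite_graph:
  fixes c d x y :: nat
  assumes "0 < c" "d \<le> c"
  shows "\<exists>(G :: nat pair_pre_digraph) U V.
    bipartite_of_order G U V (c * x) (c * y) \<and> biregular G U V (y * d) (x * d)"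
proof -
  let ?n = "c * x" and ?m = "c * y"
  \<comment> \<open>Index \<open>j\<close> of the second class is encoded as \<open>?n + j\<close>,
    which keeps the classes disjoint inside one type. \<open>E\<close> has only the arcs from the
    first class to the second; its converse supplies the reverse arcs.\<close>
  define E where "E = {(i, ?n + j) | i j. i < ?n \<and> j < ?m \<and> (i + j) mod c < d}"
  define G where "G = \<lparr>pverts = {..<?n + ?m}, parcs = E \<union> E\<inverse>\<rparr>"
  let ?U = "{..<?n}" and ?V = "{?n..<?n + ?m}"
  have arcs_subset: "parcs G \<subseteq> {..<?n + ?m} \<times> {..<?n + ?m}"
    by (auto simp: G_def E_def)
  interpret pair_graph G
  proof
    show "finite (parcs G)"
      using arcs_subset by (rule finite_subset) simp
    show "symmetric (with_proj G)"
      by (auto simp: symmetric_def G_def intro!: symI)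
  qed (use arcs_subset in \<open>auto simp: G_def E_def\<close>)
  have bip: "bipartite_graph G ?U ?V"
    unfolding bipartite_graph_def using pair_graph_axioms by (auto simp: G_def E_def)
  have "out_degree (with_proj G) i = y * d" if "i < ?n" for i
  proof -
    \<comment> \<open>All these arcs lie in \<open>E\<close>, since arcs of the converse start at
      \<open>?n\<close> or above.\<close>
    have "out_arcs (with_proj G) i = (\<lambda>j. (i, ?n + j)) ` {j. j < ?m \<and> (i + j) mod c < d}"
      using that by (auto simp: out_arcs_def G_def E_def)
    then show ?thesis
      using card_periodic_residues_less[OF assms]
      by (simp add: out_degree_def card_image inj_on_def)
  qed
  moreover have "out_degree (with_proj G) v = x * d" if "v \<in> ?V" for v
  proof -
    obtain j where j: "v = ?n + j" "j < ?m"
      using \<open>v \<in> ?V\<close> by (auto simp: le_iff_add)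
    \<comment> \<open>These arcs come from the converse of \<open>E\<close>. Commuting the sum makes
      \<open>j\<close> the shift, with \<open>x\<close> blocks to count over.\<close>
    then have "out_arcs (with_proj G) v = (\<lambda>i. (v, i)) ` {i. i < ?n \<and> (j + i) mod c < d}"
      by (auto simp: out_arcs_def G_def E_def add.commute)
    then show ?thesis
      using card_periodic_residues_less[OF assms]
      by (simp add: out_degree_def card_image inj_on_def)
  qed
  ultimately have "bipartite_of_order G ?U ?V ?n ?m \<and> biregular G ?U ?V (y * d) (x * d)"
    using bip by (simp add: bipartite_of_order_def biregular_def)
  then show ?thesis
    by blast
qed

theorem proposition4p7:
  fixes m c y p x n d a b :: nat
  assumes "m \<ge> 3"
    and "m = c * y" and "c \<ge> 2" and "y \<ge> 1"
    and "m - 1 = p * x" and "p \<ge> 1" and "x \<ge> 1"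
    and "c > p" and "x > y"
    and "n = c * x" and "d = c - p" and "a = y * d" and "b = x * d"
  shows "int b = int n - int m + 1 \<and>
    (\<exists>(G :: nat pair_pre_digraph) U V.
       bipartite_of_order G U V n m \<and> biregular G U V a b)"
proof
  \<comment> \<open>As \<open>c > p\<close>, the natural subtraction in \<open>d = c - p\<close> is
    exact and carries over to the integers.\<close>
  have "int b = int x * (int c - int p)"
    using assms by (simp add: of_nat_diff)
  also have "\<dots> = int n - int (p * x)"
    using \<open>n = c * x\<close> by (simp add: algebra_simps)
  also have "\<dots> = int n - int m + 1"
    using \<open>m - 1 = p * x\<close> \<open>m \<ge> 3\<close> by linarith
  finally show "int b = int n - int m + 1" .
  show "\<exists>(G :: nat pair_pre_digraph) U V. bipartite_of_order G U V n m \<and> biregular G U V a b"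
    using exists_biregular_bipartite_graph[of c d x y] assms by simp
qed

end
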